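(* $\frac{5}{9}\le c_1(C_5^{(3)})\le 2-\sqrt{2}$.
   Context: A $3$-graph is a $3$-uniform hypergraph. $C_5^{(3)}$ is the tight $5$-cycle: the $3$-graph on $5$ vertices with a cyclic ordering such that every $3$ cyclically consecutive vertices form an edge (5 edges in total). For a $3$-graph $G$, $\delta_1(G)$ is the minimum over vertices $v$ of the number of edges containing $v$; $G$ has an $F$-covering if every vertex of $G$ lies in a copy of $F$ in $G$. Set $c_1(n,F)=\max\{\delta_1(G): v(G)=n,\ G\text{ has no }F\text{-covering}\}$ and $c_1(F)=\lim_{n\to\infty}c_1(n,F)/\binom{n-1}{2}$ (this limit exists). *)

theory Defs
  imports Complex_Main
begin

record 'a hypergraph =
  verts :: "'a set"
  edges :: "'a set set"

definition three_graph :: "'a hypergraph \<Rightarrow> bool" where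
  "three_graph G \<longleftrightarrow> finite (verts G) \<and> (\<forall>e\<in>edges G. e \<subseteq> verts G \<and> card e = 3)"

text \<open>Subgraphs are not required to be induced.\<close>

definition subgraph :: "'a hypergraph \<Rightarrow> 'a hypergraph \<Rightarrow> bool" where
  "subgraph H G \<longleftrightarrow> three_graph H \<and> verts H \<subseteq> verts G \<and> edges H \<subseteq> edges G"

definition isomorphic :: "'a hypergraph \<Rightarrow> 'b hypergraph \<Rightarrow> bool" where
  "isomorphic F H \<longleftrightarrow> (\<exists>f. bij_betw f (verts F) (verts H) \<and> edges H = (\<lambda>e. f ` e) ` edges F)"

definition has_covering :: "'b hypergraph \<Rightarrow> 'a hypergraph \<Rightarrow> bool" where
  "has_covering F G \<longleftrightarrow>
     (\<forall>v\<in>verts G. \<exists>H. subgraph H G \<and> isomorphic F H \<and> v \<in> verts H)"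

definition degree :: "'a hypergraph \<Rightarrow> 'a \<Rightarrow> nat" where
  "degree G v = card {e \<in> edges G. v \<in> e}"

definition min_degree :: "'a hypergraph \<Rightarrow> nat" where
  "min_degree G = Min (degree G ` verts G)"

text \<open>
  Host graphs live on finite sets of natural numbers; since every finite 3-graph is isomorphic to
  such a graph, this is no restriction. For \<open>n \<ge> 1\<close> and \<open>F\<close> with at least one edge, the set below is
  finite and nonempty (it contains the degree 0 of the edgeless graph), so that \<open>Max\<close> is a genuine
  maximum; \<open>n = 0\<close> does not matter for the limit.
\<close>

definition cover_extremal :: "nat \<Rightarrow> 'b hypergraph \<Rightarrow> nat" where
  "cover_extremal n F =
     Max {min_degree G | G :: nat hypergraph.
            three_graph G \<and> card (verts G) = n \<and> \<not> has_covering F G}"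

text \<open>
  \<open>lim\<close> is a definite description and is unspecified for divergent sequences, so any bound on the
  following value rests on the existence of the limit.
\<close>

definition cover_threshold :: "'b hypergraph \<Rightarrow> real" where
  "cover_threshold F = lim (\<lambda>n. real (cover_extremal n F) / real ((n - 1) choose 2))"

definition tight_C5 :: "nat hypergraph" where
  "tight_C5 = \<lparr> verts = {..<5}, edges = {{i, (i + 1) mod 5, (i + 2) mod 5} | i. i < 5} \<rparr>"

end

theory Submission
  imports Defs
begin

text \<open>
  Every pair of vertices of the tight 5-cycle lies in an edge, so its homomorphic images are copies
  and blowing up a non-covering 3-graph leaves it non-covering. Writing \<open>c n\<close> for the extremal
  number, this gives \<open>(N div n)\<^sup>2 * c n \<le> c N\<close>, and so \<open>c n / n\<^sup>2\<close> converges to its supremum.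

  Lower bound: take a vertex \<open>v\<close> and sets \<open>A\<close>, \<open>B\<close> of sizes \<open>2 * m\<close> and \<open>m\<close>; the edges are \<open>v\<close> with
  any pair inside \<open>A\<close> or inside \<open>B\<close>, and all triples meeting both \<open>A\<close> and \<open>B\<close> but not \<open>v\<close>.

  Upper bound: let \<open>L\<close> be the link of an uncovered vertex \<open>v\<close>, \<open>F\<close> the link of a vertex \<open>a\<close> of at least
  average degree in \<open>L\<close>, \<open>N\<close> the neighbourhood of \<open>a\<close> in \<open>L\<close> and \<open>M\<close> its complement. If \<open>r - s - r'\<close> is
  a walk in \<open>H = L \<inter> F\<close> meeting \<open>N\<close>, then the pair \<open>r r'\<close> lies in neither \<open>L\<close> nor \<open>F\<close> if it meets
  \<open>N\<close>, and not in \<open>H\<close> otherwise. Any graph has at least as many (ordered) pairs with a common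
  neighbour as adjacent pairs, so these missing pairs pay for all edges of \<open>H\<close> except at most
  \<open>\<bar>M\<bar>\<^sup>2\<close>, and \<open>\<bar>L\<bar> + \<bar>F\<bar> \<le> n\<^sup>2 + \<bar>M\<bar>\<^sup>2\<close>. If both links have density at least \<open>y\<close>, this
  reads \<open>2 * y \<le> 1 + (1 - y)\<^sup>2\<close>, that is \<open>y \<le> 2 - sqrt 2\<close>.
\<close>

section \<open>Links and copies of the tight 5-cycle through a vertex\<close>

text \<open>Pairs are ordered: the link is then a symmetric relation, open to composition and
  images, and counts each edge at \<open>v\<close> twice.\<close>

definition link :: "'a hypergraph \<Rightarrow> 'a \<Rightarrow> ('a \<times> 'a) set" where
  "link G v = {(x, y). {v, x, y} \<in> edges G}"

text \<open>The cyclic order is \<open>a\<close>, \<open>b\<close>, \<open>v\<close>,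
  \<open>c\<close>, \<open>d\<close>. Distinctness is implicit: every two of the five lie in a
  listed edge, which in a 3-graph has three elements. Hence the property passes along maps that send
  edges to edges.\<close>

definition covered :: "'a hypergraph \<Rightarrow> 'a \<Rightarrow> bool" where
  "covered G v \<longleftrightarrow> (\<exists>a b c d. {a, b, v} \<in> edges G \<and> {b, v, c} \<in> edges G \<and>
     {v, c, d} \<in> edges G \<and> {c, d, a} \<in> edges G \<and> {d, a, b} \<in> edges G)"

lemma coveredI:
  assumes "{a, b, v} \<in> edges G" "{b, v, c} \<in> edges G" "{v, c, d} \<in> edges G"
    "{c, d, a} \<in> edges G" "{d, a, b} \<in> edges G"
  shows "covered G v"
  using assms unfolding covered_def by blast

lemma card3_distinct: "card {x, y, z} = 3 \<longleftrightarrow> x \<noteq> y \<and> x \<noteq> z \<and> y \<noteq> z"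
  by (auto simp: card_insert_if)

lemma three_graph_edge_distinct:
  assumes "three_graph G" "{x, y, z} \<in> edges G"
  shows "x \<noteq> y" "x \<noteq> z" "y \<noteq> z" "x \<in> verts G" "y \<in> verts G" "z \<in> verts G"
proof -
  have "card {x, y, z} = 3" "{x, y, z} \<subseteq> verts G"
    using assms by (auto simp: three_graph_def)
  then show "x \<noteq> y" "x \<noteq> z" "y \<noteq> z" "x \<in> verts G" "y \<in> verts G" "z \<in> verts G"
    by (auto simp: card3_distinct)
qed

lemma finite_three_graph_edges: "three_graph G \<Longrightarrow> finite (edges G)"
  by (rule finite_subset[of _ "Pow (verts G)"]) (auto simp: three_graph_def)

lemma link_subset: "three_graph G \<Longrightarrow> link G v \<subseteq> (verts G - {v}) \<times> (verts G - {v})"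
  by (auto simp: link_def dest: three_graph_edge_distinct)

lemma finite_link: "three_graph G \<Longrightarrow> finite (link G v)"
  by (rule finite_subset[OF link_subset]) (auto simp: three_graph_def)

lemma sym_link: "sym (link G v)"
  by (auto simp: sym_def link_def insert_commute)

lemma card_link:
  assumes G: "three_graph G"
  shows "card (link G v) = 2 * degree G v"
proof -
  let ?E = "{e \<in> edges G. v \<in> e}"
  let ?F = "\<lambda>e. {(x, y). {v, x, y} = e}"
  have two: "card (?F e) = 2 \<and> finite (?F e)" if e: "e \<in> ?E" for e
  proof -
    have "card e = 3" "v \<in> e" using e G by (auto simp: three_graph_def)
    then have "card (e - {v}) = 2" by simp
    then obtain p q where pq: "e - {v} = {p, q}" "p \<noteq> q" by (auto simp: card_2_iff)
    then have e': "e = {v, p, q}" "p \<noteq> v" "q \<noteq> v" using \<open>v \<in> e\<close> by auto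
    have "?F e = {(p, q), (q, p)}"
      using e' pq(2) by (auto simp: insert_eq_iff doubleton_eq_iff set_eq_iff)
    then show ?thesis using pq(2) by (simp add: card_insert_if)
  qed
  have "link G v = (\<Union>e\<in>?E. ?F e)" by (auto simp: link_def)
  also have "card \<dots> = (\<Sum>e\<in>?E. card (?F e))"
  proof (rule card_UN_disjoint)
    show "finite ?E" using finite_three_graph_edges[OF G] by simp
    show "\<forall>e\<in>?E. finite (?F e)" using two by blast
    show "\<forall>e\<in>?E. \<forall>e'\<in>?E. e \<noteq> e' \<longrightarrow> ?F e \<inter> ?F e' = {}" by blast
  qed
  also have "\<dots> = (\<Sum>e\<in>?E. 2)" using two by (intro sum.cong) auto
  finally show ?thesis by (simp add: degree_def)
qed

lemma edges_tight_C5: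
  "edges tight_C5 = {{0, 1, 2}, {1, 2, 3}, {2, 3, 4}, {3, 4, 0}, {4, 0, 1}}"
proof -
  have "{i. i < (5::nat)} = {0, 1, 2, 3, 4}" by auto
  then have "{{i, (i + 1) mod 5, (i + 2) mod 5} | i. i < (5::nat)} =
    (\<lambda>i. {i, (i + 1) mod 5, (i + 2) mod 5}) ` {0, 1, 2, 3, 4}"
    by (simp only: setcompr_eq_image)
  also have "\<dots> = {{0, 1, 2}, {1, 2, 3}, {2, 3, 4}, {3, 4, 0}, {4, 0, 1}}"
    by (simp add: insert_commute numeral_2_eq_2)
  finally show ?thesis by (simp add: tight_C5_def)
qed

lemma verts_tight_C5: "verts tight_C5 = {0, 1, 2, 3, 4}"
  by (auto simp: tight_C5_def)

text \<open>Rotating the cycle moves \<open>v\<close> to the middle position. Conversely, the five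
  edges contain all ten pairs, so the inequalities in \<open>dist\<close> make the witness
  \<open>f\<close> injective.\<close>

lemma covered_iff:
  assumes G: "three_graph G"
  shows "(\<exists>H. subgraph H G \<and> isomorphic tight_C5 H \<and> v \<in> verts H) \<longleftrightarrow> covered G v"
proof
  assume "\<exists>H. subgraph H G \<and> isomorphic tight_C5 H \<and> v \<in> verts H"
  then obtain H f where H: "subgraph H G" "v \<in> verts H"
    and f: "bij_betw f (verts tight_C5) (verts H)"
      "edges H = (\<lambda>e. f ` e) ` edges tight_C5"
    by (auto simp: isomorphic_def)
  have e: "{f 0, f 1, f 2} \<in> edges G" "{f 1, f 2, f 3} \<in> edges G" "{f 2, f 3, f 4} \<in> edges G"
    "{f 3, f 4, f 0} \<in> edges G" "{f 4, f 0, f 1} \<in> edges G"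
    using H(1) f(2) by (auto simp: subgraph_def edges_tight_C5)
  have "v \<in> f ` {0, 1, 2, 3, 4}"
    using f(1) H(2) by (simp add: bij_betw_def verts_tight_C5)
  then consider "v = f 0" | "v = f 1" | "v = f 2" | "v = f 3" | "v = f 4" by auto
  then show "covered G v"
  proof cases
    case 1
    show ?thesis unfolding 1
      by (rule coveredI[of "f 3" "f 4" _ _ "f 1" "f 2"]) (use e in \<open>simp_all add: insert_commute\<close>)
  next
    case 2
    show ?thesis unfolding 2
      by (rule coveredI[of "f 4" "f 0" _ _ "f 2" "f 3"]) (use e in \<open>simp_all add: insert_commute\<close>)
  next
    case 3
    show ?thesis unfolding 3
      by (rule coveredI[of "f 0" "f 1" _ _ "f 3" "f 4"]) (use e in \<open>simp_all add: insert_commute\<close>)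
  next
    case 4
    show ?thesis unfolding 4
      by (rule coveredI[of "f 1" "f 2" _ _ "f 4" "f 0"]) (use e in \<open>simp_all add: insert_commute\<close>)
  next
    case 5
    show ?thesis unfolding 5
      by (rule coveredI[of "f 2" "f 3" _ _ "f 0" "f 1"]) (use e in \<open>simp_all add: insert_commute\<close>)
  qed
next
  assume "covered G v"
  then obtain a b c d where e: "{a, b, v} \<in> edges G" "{b, v, c} \<in> edges G"
    "{v, c, d} \<in> edges G" "{c, d, a} \<in> edges G" "{d, a, b} \<in> edges G"
    by (auto simp: covered_def)
  note dist = e[THEN three_graph_edge_distinct(1)[OF G]] e[THEN three_graph_edge_distinct(2)[OF G]]
    e[THEN three_graph_edge_distinct(3)[OF G]]
  note inV = e[THEN three_graph_edge_distinct(4)[OF G]] e[THEN three_graph_edge_distinct(5)[OF G]]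
    e[THEN three_graph_edge_distinct(6)[OF G]]
  define f :: "nat \<Rightarrow> 'a" where "f = (\<lambda>i. [a, b, v, c, d] ! i)"
  define H where "H = \<lparr>verts = {a, b, v, c, d},
    edges = {{a, b, v}, {b, v, c}, {v, c, d}, {c, d, a}, {d, a, b}}\<rparr>"
  have f: "f 0 = a" "f 1 = b" "f 2 = v" "f 3 = c" "f 4 = d"
    by (simp_all add: f_def)
  have "subgraph H G"
    using e dist inV by (auto simp: subgraph_def H_def three_graph_def card3_distinct)
  moreover have "bij_betw f (verts tight_C5) (verts H)"
    using dist by (auto simp: bij_betw_def inj_on_def verts_tight_C5 H_def f simp del: One_nat_def)
  then have "isomorphic tight_C5 H"
    unfolding isomorphic_def
    by (intro exI[of _ f] conjI) (simp_all add: edges_tight_C5 H_def f del: One_nat_def)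
  moreover have "v \<in> verts H" by (simp add: H_def)
  ultimately show "\<exists>H. subgraph H G \<and> isomorphic tight_C5 H \<and> v \<in> verts H" by blast
qed

lemma has_covering_tight_C5_iff:
  "three_graph G \<Longrightarrow> has_covering tight_C5 G \<longleftrightarrow> (\<forall>v\<in>verts G. covered G v)"
  by (simp add: has_covering_def covered_iff)

section \<open>The extremal number as an attained maximum\<close>

abbreviation non_covering :: "nat \<Rightarrow> nat hypergraph \<Rightarrow> bool" where
  "non_covering n G \<equiv> three_graph G \<and> card (verts G) = n \<and> \<not> has_covering tight_C5 G"

lemma min_degree_le: "three_graph G \<Longrightarrow> v \<in> verts G \<Longrightarrow> min_degree G \<le> degree G v"
  by (auto simp: min_degree_def three_graph_def)

lemma min_degree_geI:
  assumes "three_graph G" "verts G \<noteq> {}" "\<And>v. v \<in> verts G \<Longrightarrow> k \<le> degree G v"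
  shows "k \<le> min_degree G"
  using assms by (auto simp: min_degree_def three_graph_def)

text \<open>Infinitely many host graphs qualify, since any \<open>n\<close> naturals may serve as
  vertices; finiteness comes from bounding the degrees instead.\<close>

lemma finite_min_degrees:
  assumes "n \<ge> 1"
  shows "finite {min_degree G | G. non_covering n G}"
proof (rule finite_subset)
  show "{min_degree G | G. non_covering n G} \<subseteq> {..n * n}"
  proof
    fix k assume "k \<in> {min_degree G | G. non_covering n G}"
    then obtain G :: "nat hypergraph" where G: "three_graph G" "card (verts G) = n"
      and k: "k = min_degree G" by auto
    then obtain v where v: "v \<in> verts G" using assms by fastforce
    have "2 * degree G v \<le> card (verts G \<times> verts G)"
      unfolding card_link[OF G(1), symmetric]
      by (rule card_mono) (use G link_subset[OF G(1), of v] in \<open>auto simp: three_graph_def\<close>)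
    then show "k \<in> {..n * n}"
      using min_degree_le[OF G(1) v] k G(2) by (simp add: card_cartesian_product)
  qed
qed simp

lemma cover_extremal_ge:
  "n \<ge> 1 \<Longrightarrow> non_covering n G \<Longrightarrow> min_degree G \<le> cover_extremal n tight_C5"
  unfolding cover_extremal_def by (rule Max_ge[OF finite_min_degrees]) auto

lemma cover_extremal_attained:
  assumes "n \<ge> 1"
  obtains G where "non_covering n G" "min_degree G = cover_extremal n tight_C5"
proof -
  let ?G = "\<lparr>verts = {..<n}, edges = {}\<rparr> :: nat hypergraph"
  have G: "three_graph ?G" by (simp add: three_graph_def)
  have "0 \<in> verts ?G" "\<not> covered ?G 0" using assms by (auto simp: covered_def)
  then have "non_covering n ?G" using G has_covering_tight_C5_iff[OF G] by auto
  then have "{min_degree G | G. non_covering n G} \<noteq> {}" by blast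
  from Max_in[OF finite_min_degrees[OF assms] this] that show ?thesis
    unfolding cover_extremal_def by auto
qed

section \<open>Blow-ups\<close>

text \<open>Each full block of \<open>n\<close> consecutive numbers below \<open>N\<close> contains
  one number of residue \<open>j\<close>.\<close>

lemma card_mod_fibre_ge:
  fixes j n N :: nat
  assumes "j < n"
  shows "N div n \<le> card {i. i < N \<and> i mod n = j}"
proof -
  have "(\<lambda>k. k * n + j) ` {..<N div n} \<subseteq> {i. i < N \<and> i mod n = j}"
  proof clarify
    fix k assume "k < N div n"
    then have "(k + 1) * n \<le> N"
      using assms by (metis Suc_eq_plus1 Suc_leI div_times_less_eq_dividend le_trans mult_le_mono1)
    then show "k * n + j < N \<and> (k * n + j) mod n = j" using assms by (simp add: algebra_simps)
  qed
  moreover have "inj_on (\<lambda>k. k * n + j) {..<N div n}" using assms by (auto simp: inj_on_def)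
  ultimately show ?thesis
    using card_inj_on_le[of "\<lambda>k. k * n + j" "{..<N div n}" "{i. i < N \<and> i mod n = j}"] by auto
qed

text \<open>In a blow-up of an extremal graph each vertex has at least \<open>N div n\<close>
  copies, so each link pair lifts to at least \<open>(N div n)\<^sup>2\<close> link pairs.\<close>

lemma cover_extremal_blow_up:
  assumes n: "n \<ge> 1"
  shows "(N div n)\<^sup>2 * cover_extremal n tight_C5 \<le> cover_extremal N tight_C5"
proof (cases "n \<le> N")
  case False
  then show ?thesis by simp
next
  case True
  obtain G where nc: "non_covering n G" and md: "min_degree G = cover_extremal n tight_C5"
    by (rule cover_extremal_attained[OF n])
  from nc have G: "three_graph G" "card (verts G) = n" "\<not> has_covering tight_C5 G" by simp_all
  obtain h where h: "bij_betw h {0..<n} (verts G)"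
    using ex_bij_betw_nat_finite[of "verts G"] G by (auto simp: three_graph_def)
  define \<phi> where "\<phi> i = h (i mod n)" for i
  \<comment> \<open>A triple whose image is an edge of \<open>G\<close> meets three different fibres
    of \<open>\<phi>\<close>.\<close>
  define B where "B = \<lparr>verts = {..<N}, edges = {e. e \<subseteq> {..<N} \<and> card e = 3 \<and> \<phi> ` e \<in> edges G}\<rparr>"
  have B: "three_graph B" by (simp add: three_graph_def B_def)
  have surj: "h ` {0..<n} = verts G" using h by (simp add: bij_betw_def)
  have \<phi>_in: "\<phi> i \<in> verts G" for i
    unfolding surj[symmetric] \<phi>_def by (rule imageI) (use n in simp)
  have fibre: "N div n \<le> card {i. i < N \<and> \<phi> i = p}" if p: "p \<in> verts G" for p
  proof -
    obtain j where j: "j < n" "h j = p" using p unfolding surj[symmetric] by auto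
    have "\<phi> i = p \<longleftrightarrow> i mod n = j" for i
      using inj_on_eq_iff[OF bij_betw_imp_inj_on[OF h], of "i mod n" j] j n by (simp add: \<phi>_def)
    then have "{i. i < N \<and> \<phi> i = p} = {i. i < N \<and> i mod n = j}" by simp
    then show ?thesis using card_mod_fibre_ge[OF j(1)] by simp
  qed
  obtain v where v: "v \<in> verts G" "\<not> covered G v"
    using G has_covering_tight_C5_iff by blast
  obtain j where j: "j < n" "h j = v" using v(1) unfolding surj[symmetric] by auto
  \<comment> \<open>A cycle through \<open>j\<close> is carried by \<open>\<phi>\<close> to five
    edges of \<open>G\<close> that again form a cycle, because no two of its vertices can
    collapse.\<close>
  have "\<not> covered B j"
  proof
    assume "covered B j"
    then obtain a b c d where e: "{a, b, j} \<in> edges B" "{b, j, c} \<in> edges B" "{j, c, d} \<in> edges B"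
      "{c, d, a} \<in> edges B" "{d, a, b} \<in> edges B"
      unfolding covered_def by blast
    have "{\<phi> x, \<phi> y, \<phi> z} \<in> edges G" if "{x, y, z} \<in> edges B" for x y z
      using that by (simp add: B_def)
    then have "covered G (\<phi> j)" using e by (intro coveredI[of "\<phi> a" "\<phi> b" _ _ "\<phi> c" "\<phi> d"])
    moreover have "\<phi> j = v" using j by (simp add: \<phi>_def)
    ultimately have "covered G v" by simp
    with v(2) show False by blast
  qed
  then have "non_covering N B"
    using B j True has_covering_tight_C5_iff[OF B] by (auto simp: B_def)
  moreover have "(N div n)\<^sup>2 * min_degree G \<le> min_degree B"
  proof (rule min_degree_geI[OF B])
    show "verts B \<noteq> {}" using n True by (auto simp: B_def lessThan_empty_iff)
    fix u assume u: "u \<in> verts B"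
    let ?fib = "\<lambda>p. {i. i < N \<and> \<phi> i = p}"
    have link: "(\<Union>p\<in>link G (\<phi> u). ?fib (fst p) \<times> ?fib (snd p)) \<subseteq> link B u"
    proof clarsimp
      fix x y assume xy: "x < N" "y < N" "(\<phi> x, \<phi> y) \<in> link G (\<phi> u)"
      then have "{\<phi> u, \<phi> x, \<phi> y} \<in> edges G" by (simp add: link_def)
      moreover from three_graph_edge_distinct[OF G(1) this] have "card {u, x, y} = 3"
        by (auto simp: card3_distinct)
      ultimately show "(x, y) \<in> link B u" using xy u by (simp add: link_def B_def)
    qed
    have "(N div n)\<^sup>2 * card (link G (\<phi> u)) =
        (\<Sum>p\<in>link G (\<phi> u). (N div n) * (N div n))"
      by (simp add: power2_eq_square)
    also have "\<dots> \<le> (\<Sum>p\<in>link G (\<phi> u). card (?fib (fst p) \<times> ?fib (snd p)))"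
    proof (rule sum_mono)
      fix p assume "p \<in> link G (\<phi> u)"
      then have "fst p \<in> verts G" "snd p \<in> verts G" using link_subset[OF G(1), of "\<phi> u"] by auto
      then show "N div n * (N div n) \<le> card (?fib (fst p) \<times> ?fib (snd p))"
        unfolding card_cartesian_product by (intro mult_le_mono fibre)
    qed
    also have "\<dots> = card (\<Union>p\<in>link G (\<phi> u). ?fib (fst p) \<times> ?fib (snd p))"
      by (rule card_UN_disjoint[symmetric]) (use finite_link[OF G(1)] in auto)
    also have "\<dots> \<le> card (link B u)" by (rule card_mono[OF finite_link[OF B] link])
    finally have "(N div n)\<^sup>2 * degree G (\<phi> u) \<le> degree B u"
      unfolding card_link[OF G(1)] card_link[OF B] by simp
    then show "(N div n)\<^sup>2 * min_degree G \<le> degree B u"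
      using min_degree_le[OF G(1) \<phi>_in, of u] by (meson le_trans mult_le_mono2)
  qed
  ultimately show ?thesis
    using cover_extremal_ge[of N B] n True md by simp
qed

section \<open>The lower bound construction\<close>

lemma card_Un3:
  assumes "finite X" "finite Y" "finite Z" "X \<inter> Y = {}" "X \<inter> Z = {}" "Y \<inter> Z = {}"
  shows "card (X \<union> Y \<union> Z) = card X + card Y + card Z"
  using assms by (simp add: card_Un_disjoint Int_Un_distrib2)

lemma cover_extremal_lower:
  assumes m: "m \<ge> 1"
  shows "5 * m\<^sup>2 \<le> 2 * cover_extremal (3 * m + 1) tight_C5 + 3 * m"
proof -
  define A where "A = {..<2 * m}"
  define B where "B = {2 * m..<3 * m}"
  have fin: "finite A" "finite B" and disj: "A \<inter> B = {}"
    and cards: "card A = 2 * m" "card B = m"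
    by (auto simp: A_def B_def)
  \<comment> \<open>The vertex \<open>3 * m\<close> plays the role of \<open>v\<close>. One
    equivalence describes both kinds of edges: with \<open>3 * m\<close> the other two vertices
    share a part, without it the triple lies in neither part.\<close>
  define G where "G = \<lparr>verts = {..<3 * m + 1}, edges = {e. e \<subseteq> {..<3 * m + 1} \<and> card e = 3 \<and>
     (3 * m \<in> e \<longleftrightarrow> e - {3 * m} \<subseteq> A \<or> e - {3 * m} \<subseteq> B)}\<rparr>"
  have G: "three_graph G" by (simp add: three_graph_def G_def)
  have "\<not> covered G (3 * m)"
  proof
    assume "covered G (3 * m)"
    then obtain a b c d where e: "{a, b, 3 * m} \<in> edges G" "{b, 3 * m, c} \<in> edges G"
      "{3 * m, c, d} \<in> edges G" "{c, d, a} \<in> edges G"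
      by (auto simp: covered_def)
    have dist: "a \<noteq> 3 * m" "b \<noteq> 3 * m" "c \<noteq> 3 * m" "d \<noteq> 3 * m"
      using e(1-3)[THEN three_graph_edge_distinct(1)[OF G]] e(1-3)[THEN three_graph_edge_distinct(2)[OF G]]
        e(1-3)[THEN three_graph_edge_distinct(3)[OF G]] by auto
    have part: "x \<in> A \<and> y \<in> A \<or> x \<in> B \<and> y \<in> B"
      if "{3 * m, x, y} \<in> edges G" "x \<noteq> 3 * m" "y \<noteq> 3 * m" for x y
      using that by (simp add: G_def insert_Diff_if)
    have "a \<in> A \<and> b \<in> A \<or> a \<in> B \<and> b \<in> B"
      by (rule part) (use e(1) dist in \<open>simp_all add: insert_commute\<close>)
    moreover have "b \<in> A \<and> c \<in> A \<or> b \<in> B \<and> c \<in> B"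
      by (rule part) (use e(2) dist in \<open>simp_all add: insert_commute\<close>)
    moreover have "c \<in> A \<and> d \<in> A \<or> c \<in> B \<and> d \<in> B"
      by (rule part) (use e(3) dist in simp_all)
    \<comment> \<open>The link pairs \<open>a b\<close>, \<open>b c\<close>, \<open>c d\<close> each
      stay inside one part, so all four vertices share a part, and the edge \<open>{c, d, a}\<close>
      is impossible.\<close>
    ultimately have "{c, d, a} \<subseteq> A \<or> {c, d, a} \<subseteq> B" using disj by blast
    moreover have "3 * m \<notin> {c, d, a}" using dist by simp
    ultimately show False using e(4) by (simp add: G_def)
  qed
  then have nc: "non_covering (3 * m + 1) G"
    using G has_covering_tight_C5_iff[OF G] by (auto simp: G_def)
  have off_diag: "card (X \<times> X - Id) = card X * card X - card X" if "finite X" for X :: "nat set"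
  proof -
    have "X \<times> X - Id = X \<times> X - (\<lambda>x. (x, x)) ` X" by auto
    also have "card \<dots> = card (X \<times> X) - card ((\<lambda>x. (x, x)) ` X)"
      using that by (intro card_Diff_subset) auto
    finally show ?thesis by (simp add: card_image inj_on_def card_cartesian_product)
  qed
  have AB: "A \<subseteq> {..<3 * m + 1}" "B \<subseteq> {..<3 * m + 1}" "3 * m \<notin> A" "3 * m \<notin> B"
    by (auto simp: A_def B_def)
  have same: "{3 * m, x, y} \<in> edges G" if "x \<noteq> y" "x \<in> A \<and> y \<in> A \<or> x \<in> B \<and> y \<in> B" for x y
  proof -
    have "x \<noteq> 3 * m" "y \<noteq> 3 * m" "x < 3 * m + 1" "y < 3 * m + 1" using that AB by auto
    then show ?thesis using that by (simp add: G_def card3_distinct insert_Diff_if)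
  qed
  have cross: "{x, y, z} \<in> edges G" if "x \<in> A" "y \<in> B" "z \<in> A \<union> B" "z \<noteq> x" "z \<noteq> y" for x y z
  proof -
    have "{x, y, z} \<subseteq> {..<3 * m + 1}" "3 * m \<notin> {x, y, z}" using that AB by blast+
    moreover have "\<not> {x, y, z} \<subseteq> A" "\<not> {x, y, z} \<subseteq> B" "x \<noteq> y" using that disj by blast+
    moreover from \<open>x \<noteq> y\<close> have "card {x, y, z} = 3" using that by (simp add: card3_distinct)
    ultimately show ?thesis unfolding G_def by simp
  qed
  have link_v: "(A \<times> A - Id) \<union> (B \<times> B - Id) \<subseteq> link G (3 * m)"
  proof clarify
    fix y z assume "(y, z) \<in> (A \<times> A - Id) \<union> (B \<times> B - Id)"
    then have "y \<noteq> z" "y \<in> A \<and> z \<in> A \<or> y \<in> B \<and> z \<in> B" by blast+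
    from same[OF this] show "(y, z) \<in> link G (3 * m)" by (simp add: link_def)
  qed
  \<comment> \<open>Link pairs containing \<open>3 * m\<close> are left out of the count; their
    number is only linear in \<open>m\<close>.\<close>
  have link_A: "((A - {x}) \<times> B) \<union> (B \<times> (A - {x})) \<union> (B \<times> B - Id) \<subseteq> link G x" if x: "x \<in> A" for x
  proof clarify
    fix y z assume "(y, z) \<in> ((A - {x}) \<times> B) \<union> (B \<times> (A - {x})) \<union> (B \<times> B - Id)"
    then consider "y \<in> A" "z \<in> B" "y \<noteq> x" | "y \<in> B" "z \<in> A \<union> B" "z \<noteq> x" "z \<noteq> y"
      using x disj by blast
    then have "{x, y, z} \<in> edges G \<or> {x, z, y} \<in> edges G"
    proof cases
      case 1
      then show ?thesis using cross[of x z y] x disj by blast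
    next
      case 2
      then show ?thesis using cross[of x y z] x by blast
    qed
    moreover have "{x, z, y} = {x, y, z}" by blast
    ultimately show "(y, z) \<in> link G x" by (simp add: link_def)
  qed
  have link_B: "((B - {x}) \<times> A) \<union> (A \<times> (B - {x})) \<union> (A \<times> A - Id) \<subseteq> link G x" if x: "x \<in> B" for x
  proof clarify
    fix y z assume "(y, z) \<in> ((B - {x}) \<times> A) \<union> (A \<times> (B - {x})) \<union> (A \<times> A - Id)"
    then consider "z \<in> A" "y \<in> A \<union> B" "y \<noteq> x" "y \<noteq> z" | "y \<in> A" "z \<in> B" "z \<noteq> x"
      using x disj by blast
    then have "{z, x, y} \<in> edges G \<or> {y, x, z} \<in> edges G"
    proof cases
      case 1
      then show ?thesis using cross[of z x y] x by blast
    next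
      case 2
      then show ?thesis using cross[of y x z] x disj by blast
    qed
    moreover have "{z, x, y} = {x, y, z}" "{y, x, z} = {x, y, z}" by blast+
    ultimately show "(y, z) \<in> link G x" by (simp add: link_def)
  qed
  have deg: "5 * m\<^sup>2 \<le> 2 * degree G u + 3 * m" if "u \<in> verts G" for u
  proof -
    have u: "u = 3 * m \<or> u \<in> A \<or> u \<in> B" using that by (auto simp: G_def A_def B_def)
    obtain k where k: "m = Suc k" using m by (cases m) auto
    \<comment> \<open>The counts are \<open>5 * m\<^sup>2 - 3 * m\<close> for \<open>3 * m\<close>
      and for \<open>A\<close>, and \<open>8 * m\<^sup>2 - 6 * m\<close> for \<open>B\<close>; the
      ratio 2 : 1 of the parts balances the first two. Writing \<open>m = Suc k\<close> resolves the
      truncated subtractions.\<close>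
    have "5 * m\<^sup>2 \<le> card (link G u) + 3 * m"
      using u
    proof (elim disjE)
      assume [simp]: "u = 3 * m"
      have "card ((A \<times> A - Id) \<union> (B \<times> B - Id)) = card (A \<times> A - Id) + card (B \<times> B - Id)"
        using fin disj by (intro card_Un_disjoint) auto
      with card_mono[OF finite_link[OF G] link_v] show ?thesis
        by (simp add: off_diag fin cards k power2_eq_square)
    next
      assume x: "u \<in> A"
      have "card (((A - {u}) \<times> B) \<union> (B \<times> (A - {u})) \<union> (B \<times> B - Id)) =
        card ((A - {u}) \<times> B) + card (B \<times> (A - {u})) + card (B \<times> B - Id)"
        using fin disj by (intro card_Un3) auto
      with card_mono[OF finite_link[OF G] link_A[OF x]] x show ?thesis
        by (simp add: off_diag fin cards card_cartesian_product k power2_eq_square)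
    next
      assume x: "u \<in> B"
      have "card (((B - {u}) \<times> A) \<union> (A \<times> (B - {u})) \<union> (A \<times> A - Id)) =
        card ((B - {u}) \<times> A) + card (A \<times> (B - {u})) + card (A \<times> A - Id)"
        using fin disj by (intro card_Un3) auto
      with card_mono[OF finite_link[OF G] link_B[OF x]] x show ?thesis
        by (simp add: off_diag fin cards card_cartesian_product k power2_eq_square)
    qed
    then show ?thesis by (simp add: card_link[OF G])
  qed
  have "min_degree G \<in> degree G ` verts G"
    unfolding min_degree_def by (rule Min_in) (auto simp: G_def)
  then have "5 * m\<^sup>2 \<le> 2 * min_degree G + 3 * m" using deg by auto
  with cover_extremal_ge[OF _ nc] show ?thesis by simp
qed

section \<open>The upper bound: counting pairs in two links\<close>

lemma card_eq_sum_Image: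
  assumes "finite K" "Domain K \<subseteq> X" "finite X"
  shows "card K = (\<Sum>x\<in>X. card (K `` {x}))"
proof -
  have "K = Sigma X (\<lambda>x. K `` {x})" using assms(2) by auto
  then have "card K = card (Sigma X (\<lambda>x. K `` {x}))" by simp
  also have "\<dots> = (\<Sum>x\<in>X. card (K `` {x}))"
    using assms by (intro card_SigmaI) auto
  finally show ?thesis .
qed

text \<open>
  A vertex \<open>x\<close> has at least \<open>d y\<close> second neighbours for each neighbour \<open>y\<close>, hence at least the average
  of these degrees; summing the terms \<open>d y / d x + d x / d y \<ge> 2\<close> over the edges gives the claim.
\<close>

lemma card_le_card_relcomp:
  assumes fin: "finite K" and sym: "sym K"
  shows "card K \<le> card (K O K)"
proof -
  define d :: "_ \<Rightarrow> real" where "d x = card (K `` {x})" for x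
  have pos: "d x > 0" "d y > 0" if "(x, y) \<in> K" for x y
    using that fin symD[OF sym that] unfolding d_def by (auto simp: card_gt_0_iff)
  have "real (card K) \<le> (\<Sum>p\<in>K. (d (snd p) / d (fst p) + d (fst p) / d (snd p)) / 2)"
  proof -
    have "1 \<le> (d (snd p) / d (fst p) + d (fst p) / d (snd p)) / 2" if "p \<in> K" for p
    proof -
      have "d (fst p) > 0" "d (snd p) > 0" using pos[of "fst p" "snd p"] that by auto
      moreover have "0 \<le> (d (fst p) - d (snd p))\<^sup>2" by simp
      ultimately show ?thesis by (simp add: field_simps power2_eq_square)
    qed
    then have "(\<Sum>p\<in>K. 1) \<le> (\<Sum>p\<in>K. (d (snd p) / d (fst p) + d (fst p) / d (snd p)) / 2)"
      by (rule sum_mono)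
    then show ?thesis by simp
  qed
  also have "\<dots> = (\<Sum>p\<in>K. d (snd p) / d (fst p))"
  proof -
    have "(\<Sum>p\<in>K. d (fst p) / d (snd p)) = (\<Sum>p\<in>K. d (snd p) / d (fst p))"
      by (rule sum.reindex_bij_witness[of _ prod.swap prod.swap]) (use sym in \<open>auto simp: sym_def\<close>)
    then show ?thesis by (simp add: sum.distrib flip: sum_divide_distrib)
  qed
  also have "\<dots> = (\<Sum>x\<in>Domain K. \<Sum>y\<in>K `` {x}. d y / d x)"
  proof -
    have "K = Sigma (Domain K) (\<lambda>x. K `` {x})" by auto
    then have "(\<Sum>p\<in>K. d (snd p) / d (fst p)) =
      (\<Sum>p\<in>Sigma (Domain K) (\<lambda>x. K `` {x}). d (snd p) / d (fst p))" by simp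
    also have "\<dots> = (\<Sum>x\<in>Domain K. \<Sum>y\<in>K `` {x}. d y / d x)"
      using fin by (subst sum.Sigma) (auto simp: finite_Domain split_def)
    finally show ?thesis .
  qed
  also have "\<dots> \<le> (\<Sum>x\<in>Domain K. real (card ((K O K) `` {x})))"
  proof (rule sum_mono)
    fix x assume "x \<in> Domain K"
    then have x: "d x > 0" using pos by auto
    have "d y / d x \<le> card ((K O K) `` {x}) / d x" if "y \<in> K `` {x}" for y
    proof -
      have "card (K `` {y}) \<le> card ((K O K) `` {x})"
        using that fin by (intro card_mono) auto
      then show ?thesis using x unfolding d_def by (intro divide_right_mono) auto
    qed
    then have "(\<Sum>y\<in>K `` {x}. d y / d x) \<le> (\<Sum>y\<in>K `` {x}. card ((K O K) `` {x}) / d x)"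
      by (rule sum_mono)
    also have "\<dots> = card ((K O K) `` {x})" using x by (simp add: d_def)
    finally show "(\<Sum>y\<in>K `` {x}. d y / d x) \<le> real (card ((K O K) `` {x}))" .
  qed
  also have "\<dots> = card (K O K)"
    using fin by (subst card_eq_sum_Image[of "K O K" "Domain K"]) (auto simp: finite_Domain)
  finally show ?thesis by simp
qed

text \<open>In the application \<open>no_path\<close> expresses that \<open>v\<close> is uncovered:
  the walk \<open>b\<close>, \<open>c\<close>, \<open>d\<close> would complete a tight cycle with
  \<open>v\<close> and \<open>a\<close>.\<close>

lemma card_links_le:
  assumes fin: "finite W" and N: "N \<subseteq> W"
    and L: "L \<subseteq> W \<times> W" "sym L" and F: "F \<subseteq> W \<times> W" "sym F"
    and no_path: "\<And>b c d. b \<in> N \<Longrightarrow> (b, c) \<in> L \<Longrightarrow> (c, d) \<in> L \<Longrightarrow> (c, d) \<in> F \<Longrightarrow> (b, d) \<in> F \<Longrightarrow> False"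
  shows "card L + card F \<le> (card W)\<^sup>2 + (card (W - N))\<^sup>2"
proof -
  define M where "M = W - N"
  define H where "H = L \<inter> F"
  \<comment> \<open>Dropping the pairs inside \<open>M\<close> ensures that a walk in
    \<open>K\<close> with both ends in \<open>M\<close> has its middle vertex in
    \<open>N\<close>.\<close>
  define K where "K = H - M \<times> M"
  define D where "D = K O K"
  have finW: "finite (W \<times> W)" using fin by simp
  have sub: "H \<subseteq> W \<times> W" "K \<subseteq> W \<times> W" "D \<subseteq> W \<times> W" "M \<times> M \<subseteq> W \<times> W"
    using L F by (auto simp: H_def K_def D_def M_def)
  note fins = finite_subset[OF _ finW]
  have symH: "sym H" using L F by (auto simp: H_def sym_def)
  then have symK: "sym K" by (auto simp: K_def sym_def)
  \<comment> \<open>If \<open>(b, r)\<close> were in \<open>F\<close>, the walk \<open>b\<close>,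
    \<open>q\<close>, \<open>r\<close> would be forbidden; if it were in \<open>L\<close>, the walk
    \<open>b\<close>, \<open>r\<close>, \<open>q\<close> would be.\<close>
  have miss: "(b, r) \<notin> L \<and> (b, r) \<notin> F" if "b \<in> N" "(b, q) \<in> H" "(q, r) \<in> H" for b q r
    using that no_path[of b q r] no_path[of b r q] symD[OF symH, of q r] by (auto simp: H_def)
  have D1: "(D - M \<times> M) \<inter> (L \<union> F) = {}"
  proof (rule ccontr)
    assume "(D - M \<times> M) \<inter> (L \<union> F) \<noteq> {}"
    then obtain r r' s where rr: "(r, s) \<in> H" "(s, r') \<in> H" "(r, r') \<notin> M \<times> M"
      "(r, r') \<in> L \<union> F" by (auto simp: D_def K_def)
    then have "r \<in> N \<or> r' \<in> N" using sub(1) by (auto simp: M_def)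
    then show False
      using miss[of r s r'] miss[of r' s r] rr symD[OF symH rr(1)] symD[OF symH rr(2)]
        symD[OF L(2), of r r'] symD[OF F(2), of r r'] by auto
  qed
  \<comment> \<open>Here the middle vertex \<open>s\<close> lies in \<open>N\<close>, and the
    forbidden walk is \<open>s\<close>, \<open>r\<close>, \<open>r'\<close>.\<close>
  have D2: "(D \<inter> M \<times> M) \<inter> H = {}"
  proof (rule ccontr)
    assume "(D \<inter> M \<times> M) \<inter> H \<noteq> {}"
    then obtain r r' s where rr: "(r, s) \<in> H" "(s, r') \<in> H" "s \<notin> M" "(r, r') \<in> H"
      by (auto simp: D_def K_def)
    then have "s \<in> N" using sub(1) by (auto simp: M_def)
    then show False
      using no_path[of s r r'] rr symD[OF symH rr(1)] by (auto simp: H_def)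
  qed
  have "card (L \<union> F) + card (D - M \<times> M) = card ((L \<union> F) \<union> (D - M \<times> M))"
    using D1 L F sub by (intro card_Un_disjoint[symmetric] fins) auto
  also have "\<dots> \<le> card (W \<times> W)" using L F sub by (intro card_mono finW) auto
  finally have 1: "card (L \<union> F) + card (D - M \<times> M) \<le> card W * card W"
    by (simp add: card_cartesian_product)
  have "card (H \<inter> M \<times> M) + card (D \<inter> M \<times> M) = card ((H \<inter> M \<times> M) \<union> (D \<inter> M \<times> M))"
    using D2 sub by (intro card_Un_disjoint[symmetric] fins) auto
  also have "\<dots> \<le> card (M \<times> M)" using fin by (intro card_mono) (auto simp: M_def)
  finally have 2: "card (H \<inter> M \<times> M) + card (D \<inter> M \<times> M) \<le> card M * card M"
    by (simp add: card_cartesian_product)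
  have 3: "card L + card F = card (L \<union> F) + card H"
    unfolding H_def using L F by (intro card_Un_Int fins) auto
  have 4: "card H = card (H \<inter> M \<times> M) + card K"
    unfolding K_def by (rule card_Int_Diff[OF fins[OF sub(1)]])
  have 5: "card D = card (D \<inter> M \<times> M) + card (D - M \<times> M)"
    by (rule card_Int_Diff[OF fins[OF sub(3)]])
  \<comment> \<open>The part of \<open>D\<close> outside \<open>M \<times> M\<close> is paid for by
    fact 1 and the part inside by fact 2, so \<open>D\<close> compensates for all of
    \<open>K\<close>.\<close>
  have "card K \<le> card D"
    unfolding D_def by (rule card_le_card_relcomp[OF fins[OF sub(2)] symK])
  with 1 2 3 4 5 show ?thesis by (simp add: power2_eq_square M_def)
qed

text \<open>The number \<open>l\<close> is the degree of a vertex \<open>a\<close> in the link of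
  \<open>v\<close>. The term \<open>4 * l\<close> accounts for the link pairs lost when
  \<open>v\<close> and \<open>a\<close> are removed.\<close>

lemma uncovered_degree_bound:
  assumes G: "three_graph G" and v: "v \<in> verts G" "\<not> covered G v"
    and \<delta>: "\<And>u. u \<in> verts G \<Longrightarrow> \<delta> \<le> degree G u"
  defines "n \<equiv> card (verts G)"
  obtains l where "2 * \<delta> \<le> n * l" "l \<le> n" "4 * \<delta> \<le> n\<^sup>2 + (n - l)\<^sup>2 + 4 * l"
proof -
  have fin: "finite (verts G)" using G by (simp add: three_graph_def)
  \<comment> \<open>Averaging: the degrees in the link of \<open>v\<close> sum to twice the degree
    of \<open>v\<close>, hence to at least \<open>2 * \<delta>\<close>.\<close>
  have "\<exists>a\<in>verts G. 2 * \<delta> \<le> n * card (link G v `` {a})"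
  proof (rule ccontr)
    assume neg: "\<not> ?thesis"
    have "n * (2 * \<delta>) \<le> n * card (link G v)" using \<delta>[OF v(1)] by (simp add: card_link[OF G])
    also have "\<dots> = (\<Sum>a\<in>verts G. n * card (link G v `` {a}))"
      using link_subset[OF G, of v] fin finite_link[OF G]
      by (subst card_eq_sum_Image[of _ "verts G"]) (auto simp: sum_distrib_left)
    also have "\<dots> < (\<Sum>a\<in>verts G. 2 * \<delta>)"
      using neg v fin by (intro sum_strict_mono) (auto simp: not_le)
    finally show False by (simp add: n_def)
  qed
  then obtain a where a: "a \<in> verts G" and l: "2 * \<delta> \<le> n * card (link G v `` {a})" by blast
  define N where "N = link G v `` {a}"
  define W where "W = verts G - {v, a}"
  define L where "L = link G v \<inter> W \<times> W"
  define F where "F = link G a \<inter> W \<times> W"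
  have lv: "link G v \<subseteq> (verts G - {v}) \<times> (verts G - {v})"
    and la: "link G a \<subseteq> (verts G - {a}) \<times> (verts G - {a})"
    using link_subset[OF G] by auto
  have NW: "N \<subseteq> W"
    using lv by (auto simp: N_def W_def link_def dest: three_graph_edge_distinct[OF G])
  have finW: "finite W" using fin by (simp add: W_def)
  have finN: "finite N" using NW finW finite_subset by blast
  have "card L + card F \<le> (card W)\<^sup>2 + (card (W - N))\<^sup>2"
  proof (rule card_links_le[OF finW NW])
    show "L \<subseteq> W \<times> W" "F \<subseteq> W \<times> W" by (auto simp: L_def F_def)
    show "sym L" "sym F" using sym_link[of G] by (auto simp: L_def F_def sym_def)
    fix b c d
    assume "b \<in> N" "(b, c) \<in> L" "(c, d) \<in> L" "(c, d) \<in> F" "(b, d) \<in> F"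
    then have "{v, a, b} \<in> edges G" "{v, b, c} \<in> edges G" "{v, c, d} \<in> edges G"
      "{a, c, d} \<in> edges G" "{a, b, d} \<in> edges G"
      by (auto simp: N_def L_def F_def link_def)
    \<comment> \<open>The cyclic order is \<open>a\<close>, \<open>b\<close>, \<open>v\<close>,
      \<open>c\<close>, \<open>d\<close>.\<close>
    then have "covered G v"
      by (intro coveredI[of a b v G c d]) (simp_all add: insert_commute)
    with v show False by blast
  qed
  moreover have "2 * degree G v \<le> card L + 2 * card N"
  proof -
    have "link G v \<subseteq> L \<union> ({a} \<times> N \<union> N \<times> {a})"
      using lv symD[OF sym_link[of G v]] by (auto simp: L_def W_def N_def)
    then have "card (link G v) \<le> card (L \<union> ({a} \<times> N \<union> N \<times> {a}))"
      using finN finW by (intro card_mono) (auto simp: L_def)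
    also have "\<dots> \<le> card L + (card ({a} \<times> N) + card (N \<times> {a}))"
      by (meson card_Un_le le_trans add_le_mono order_refl)
    finally show ?thesis by (simp add: card_link[OF G] card_cartesian_product)
  qed
  moreover have "2 * degree G a \<le> card F + 2 * card N"
  proof -
    \<comment> \<open>The neighbourhood of \<open>v\<close> in the link of \<open>a\<close> is again
      \<open>N\<close>, as both are given by the edges through \<open>v\<close> and
      \<open>a\<close>.\<close>
    have "link G a \<subseteq> F \<union> ({v} \<times> N \<union> N \<times> {v})"
      using la by (auto simp: F_def W_def N_def link_def insert_commute)
    then have "card (link G a) \<le> card (F \<union> ({v} \<times> N \<union> N \<times> {v}))"
      using finN finW by (intro card_mono) (auto simp: F_def)
    also have "\<dots> \<le> card F + (card ({v} \<times> N) + card (N \<times> {v}))"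
      by (meson card_Un_le le_trans add_le_mono order_refl)
    finally show ?thesis by (simp add: card_link[OF G] card_cartesian_product)
  qed
  ultimately have "4 * \<delta> \<le> (card W)\<^sup>2 + (card (W - N))\<^sup>2 + 4 * card N"
    using \<delta>[OF v(1)] \<delta>[OF a] by linarith
  moreover have Wn: "card W \<le> n" unfolding n_def W_def by (rule card_mono[OF fin]) auto
  moreover have "card (W - N) \<le> n - card N"
    using Wn card_Diff_subset[OF finN NW] by simp
  ultimately have "4 * \<delta> \<le> n\<^sup>2 + (n - card N)\<^sup>2 + 4 * card N"
    by (meson add_le_mono le_trans order_refl power_mono zero_le)
  moreover have "card N \<le> n" using card_mono[OF finW NW] Wn by linarith
  ultimately show ?thesis using that l N_def by blast
qed

text \<open>The second bound is \<open>2 * y \<le> 1 + (1 - y)\<^sup>2 + 4 / n\<close> with the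
  square completed.\<close>

lemma cover_extremal_upper:
  assumes n: "n \<ge> 1"
  defines "y \<equiv> 2 * real (cover_extremal n tight_C5) / real n ^ 2"
  shows "y \<le> 1" "2 - 4 / real n \<le> (2 - y)\<^sup>2"
proof -
  obtain G where nc: "non_covering n G" and md: "min_degree G = cover_extremal n tight_C5"
    by (rule cover_extremal_attained[OF n])
  from nc have G: "three_graph G" "card (verts G) = n" "\<not> has_covering tight_C5 G" by simp_all
  obtain v where v: "v \<in> verts G" "\<not> covered G v"
    using G has_covering_tight_C5_iff by blast
  obtain l where l: "2 * min_degree G \<le> n * l" "l \<le> n"
    "4 * min_degree G \<le> n\<^sup>2 + (n - l)\<^sup>2 + 4 * l"
    using uncovered_degree_bound[OF G(1) v min_degree_le[OF G(1)]] G(2) by metis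
  define z where "z = real l / real n"
  have n0: "real n > 0" using n by simp
  have z1: "z \<le> 1" using l(2) n0 by (simp add: z_def)
  have "2 * real (min_degree G) \<le> real n * real l"
    using l(1) by (metis of_nat_le_iff of_nat_mult of_nat_numeral)
  then have yz: "y \<le> z" using n0 by (simp add: y_def z_def md field_simps power2_eq_square)
  with z1 show "y \<le> 1" by simp
  have "real (4 * min_degree G) \<le> real (n\<^sup>2 + (n - l)\<^sup>2 + 4 * l)" using l(3) of_nat_le_iff by blast
  then have "4 * real (min_degree G) \<le> real n ^ 2 + (real n - real l)\<^sup>2 + 4 * real l"
    using l(2) by (simp add: of_nat_diff)
  then have "4 * real (min_degree G) / real n ^ 2 \<le>
      (real n ^ 2 + (real n - real l)\<^sup>2 + 4 * real l) / real n ^ 2"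
    by (rule divide_right_mono) simp
  then have "2 * y \<le> 1 + (1 - z)\<^sup>2 + 4 * z / real n"
    using n0 by (simp add: y_def z_def md field_simps power2_eq_square)
  \<comment> \<open>The averaging bound \<open>y \<le> z\<close> enters here: a larger degree
    \<open>l\<close> only shrinks the complement of \<open>N\<close>.\<close>
  moreover have "(1 - z)\<^sup>2 \<le> (1 - y)\<^sup>2" using z1 yz by (intro power_mono) auto
  moreover have "4 * z / real n \<le> 4 / real n" using z1 n0 by (intro divide_right_mono) auto
  ultimately show "2 - 4 / real n \<le> (2 - y)\<^sup>2"
    by (simp add: power2_eq_square algebra_simps)
qed

section \<open>Existence of the limit and its bounds\<close>

lemma div_over_tendsto:
  fixes n :: nat
  assumes "n \<ge> 1"
  shows "(\<lambda>N. real (N div n) / real N) \<longlonglongrightarrow> 1 / real n"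
proof (rule tendsto_sandwich[OF _ _ _ tendsto_const])
  show "\<forall>\<^sub>F N in sequentially. 1 / real n - 1 / real N \<le> real (N div n) / real N"
    using eventually_gt_at_top[of 0]
  proof eventually_elim
    case (elim N)
    have "real N / real n \<le> real (N div n) + 1"
      using floor_divide_of_nat_eq[of N n, where ?'a = real] by linarith
    then have "(real N / real n - 1) / real N \<le> real (N div n) / real N"
      by (intro divide_right_mono) auto
    then show ?case using elim by (simp add: diff_divide_distrib)
  qed
  show "\<forall>\<^sub>F N in sequentially. real (N div n) / real N \<le> 1 / real n"
    using eventually_gt_at_top[of 0]
  proof eventually_elim
    case (elim N)
    have "real (N div n) \<le> real N / real n"
      using floor_divide_of_nat_eq[of N n, where ?'a = real] by linarith
    then have "real (N div n) / real N \<le> (real N / real n) / real N"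
      by (intro divide_right_mono) auto
    then show ?case using elim by simp
  qed
  have "(\<lambda>N. 1 / real n - 1 / real N) \<longlonglongrightarrow> 1 / real n - 0"
    by (intro tendsto_intros lim_1_over_n)
  then show "(\<lambda>N. 1 / real n - 1 / real N) \<longlonglongrightarrow> 1 / real n" by simp
qed

text \<open>For fixed \<open>n\<close> the ratio at \<open>N\<close> is at least
  \<open>(N div n / N)\<^sup>2 * c n\<close>, which tends to the ratio at \<open>n\<close>. So the
  ratios eventually exceed anything below their supremum \<open>s\<close>.\<close>

lemma convergent_of_quadratic_superhomogeneous:
  fixes c :: "nat \<Rightarrow> nat"
  assumes super: "\<And>n N. n \<ge> 1 \<Longrightarrow> (N div n)\<^sup>2 * c n \<le> c N"
    and bdd: "\<And>n. n \<ge> 1 \<Longrightarrow> real (c n) / real n ^ 2 \<le> B"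
  shows "convergent (\<lambda>n. real (c n) / real n ^ 2)"
proof -
  let ?f = "\<lambda>n. real (c n) / real n ^ 2"
  define s where "s = (SUP n\<in>{1..}. ?f n)"
  have bddA: "bdd_above (?f ` {1..})" using bdd by (auto intro: bdd_aboveI2[of _ _ B])
  have "?f \<longlonglongrightarrow> s"
  proof (rule order_tendstoI)
    fix a assume "a < s"
    then obtain n where n: "n \<ge> 1" "a < ?f n"
      using less_cSUP_iff[of "{1..}" ?f a] bddA by (auto simp: s_def)
    have "(\<lambda>N. (real (N div n) / real N)\<^sup>2 * real (c n)) \<longlonglongrightarrow> (1 / real n)\<^sup>2 * real (c n)"
      by (intro tendsto_intros div_over_tendsto n)
    then have "(\<lambda>N. (real (N div n) / real N)\<^sup>2 * real (c n)) \<longlonglongrightarrow> ?f n"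
      by (simp add: power_divide)
    from order_tendstoD(1)[OF this n(2)]
    show "\<forall>\<^sub>F N in sequentially. a < ?f N"
    proof eventually_elim
      case (elim N)
      have "real ((N div n)\<^sup>2 * c n) \<le> real (c N)" using super[OF n(1)] of_nat_le_iff by blast
      then have "real ((N div n)\<^sup>2 * c n) / real N ^ 2 \<le> ?f N" by (rule divide_right_mono) simp
      with elim show ?case by (simp add: power_divide)
    qed
  next
    fix a assume "s < a"
    show "\<forall>\<^sub>F N in sequentially. ?f N < a"
      using eventually_ge_at_top[of 1]
    proof eventually_elim
      case (elim N)
      have "?f N \<le> s" unfolding s_def by (rule cSUP_upper[OF _ bddA]) (use elim in auto)
      with \<open>s < a\<close> show ?case by simp
    qed
  qed
  then show ?thesis by (rule convergentI)
qed

theorem theorem2p5: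
  shows "5 / 9 \<le> cover_threshold tight_C5 \<and> cover_threshold tight_C5 \<le> 2 - sqrt 2"
proof -
  define c where "c n = cover_extremal n tight_C5" for n
  have "convergent (\<lambda>n. real (c n) / real n ^ 2)"
  proof (rule convergent_of_quadratic_superhomogeneous[where B = 1])
    show "(N div n)\<^sup>2 * c n \<le> c N" if "n \<ge> 1" for n N
      unfolding c_def by (rule cover_extremal_blow_up[OF that])
    show "real (c n) / real n ^ 2 \<le> 1" if "n \<ge> 1" for n
      using cover_extremal_upper(1)[OF that] unfolding c_def by simp
  qed
  then obtain s where s: "(\<lambda>n. real (c n) / real n ^ 2) \<longlonglongrightarrow> s" by (auto simp: convergent_def)
  \<comment> \<open>The factor 2 reflects that \<open>(n - 1) choose 2\<close> is asymptotically
    half of \<open>n\<^sup>2\<close>.\<close>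
  define y where "y n = 2 * real (c n) / real n ^ 2" for n
  have y: "y \<longlonglongrightarrow> 2 * s" using tendsto_mult[OF tendsto_const[of 2] s] by (simp add: y_def[abs_def])
  have q: "(\<lambda>n. real n ^ 2 / (2 * real ((n - 1) choose 2))) \<longlonglongrightarrow> 1"
  proof (rule Lim_transform_eventually)
    show "(\<lambda>n. real n ^ 2 / ((real n - 1) * (real n - 2))) \<longlonglongrightarrow> 1"
    proof (rule Lim_transform_eventually)
      have "(\<lambda>n. 1 / ((1 - 1 / real n) * (1 - 2 * (1 / real n)))) \<longlonglongrightarrow> 1 / ((1 - 0) * (1 - 2 * 0))"
        by (intro tendsto_intros lim_1_over_n) auto
      then show "(\<lambda>n. 1 / ((1 - 1 / real n) * (1 - 2 * (1 / real n)))) \<longlonglongrightarrow> 1" by simp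
      show "\<forall>\<^sub>F n in sequentially. 1 / ((1 - 1 / real n) * (1 - 2 * (1 / real n))) =
          real n ^ 2 / ((real n - 1) * (real n - 2))"
        using eventually_gt_at_top[of 2]
        by eventually_elim (simp add: field_simps power2_eq_square)
    qed
    show "\<forall>\<^sub>F n in sequentially. real n ^ 2 / ((real n - 1) * (real n - 2)) =
        real n ^ 2 / (2 * real ((n - 1) choose 2))"
      using eventually_ge_at_top[of 2]
      by eventually_elim (simp add: choose_two real_of_nat_div of_nat_diff)
  qed
  have "(\<lambda>n. y n * (real n ^ 2 / (2 * real ((n - 1) choose 2)))) \<longlonglongrightarrow> 2 * s * 1"
    by (rule tendsto_mult[OF y q])
  moreover have "\<forall>\<^sub>F n in sequentially. y n * (real n ^ 2 / (2 * real ((n - 1) choose 2))) =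
      real (c n) / real ((n - 1) choose 2)"
    using eventually_gt_at_top[of 0] by eventually_elim (simp add: y_def)
  ultimately have "(\<lambda>n. real (c n) / real ((n - 1) choose 2)) \<longlonglongrightarrow> 2 * s"
    using tendsto_cong by force
  then have thr: "cover_threshold tight_C5 = 2 * s"
    unfolding cover_threshold_def c_def by (rule limI)
  have "5 / 9 \<le> 2 * s"
  proof (rule LIMSEQ_le)
    \<comment> \<open>As the limit exists, the orders \<open>3 * m + 1\<close> of the construction
      determine it.\<close>
    show "(\<lambda>m. y (3 * m + 1)) \<longlonglongrightarrow> 2 * s"
      using LIMSEQ_subseq_LIMSEQ[OF y, of "\<lambda>m. 3 * m + 1"] by (simp add: strict_mono_def o_def)
    show "(\<lambda>m. (5 * real m ^ 2 - 3 * real m) / (3 * real m + 1)\<^sup>2) \<longlonglongrightarrow> 5 / 9"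
    proof (rule Lim_transform_eventually)
      have "(\<lambda>m. (5 - 3 * (1 / real m)) / (3 + 1 / real m)\<^sup>2) \<longlonglongrightarrow> (5 - 3 * 0) / (3 + 0)\<^sup>2"
        by (intro tendsto_intros lim_1_over_n) auto
      then show "(\<lambda>m. (5 - 3 * (1 / real m)) / (3 + 1 / real m)\<^sup>2) \<longlonglongrightarrow> 5 / 9" by simp
      show "\<forall>\<^sub>F m in sequentially. (5 - 3 * (1 / real m)) / (3 + 1 / real m)\<^sup>2 =
          (5 * real m ^ 2 - 3 * real m) / (3 * real m + 1)\<^sup>2"
        using eventually_gt_at_top[of 0]
        by eventually_elim (simp add: divide_simps power2_eq_square, simp add: algebra_simps)
    qed
    show "\<exists>N. \<forall>m\<ge>N. (5 * real m ^ 2 - 3 * real m) / (3 * real m + 1)\<^sup>2 \<le> y (3 * m + 1)"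
    proof (intro exI[of _ 1] allI impI)
      fix m :: nat assume "1 \<le> m"
      from cover_extremal_lower[OF this]
      have "real (5 * m\<^sup>2) \<le> real (2 * c (3 * m + 1) + 3 * m)" unfolding c_def of_nat_le_iff .
      then have "5 * real m ^ 2 - 3 * real m \<le> 2 * real (c (3 * m + 1))" by simp
      then have "(5 * real m ^ 2 - 3 * real m) / (3 * real m + 1)\<^sup>2 \<le>
        2 * real (c (3 * m + 1)) / (3 * real m + 1)\<^sup>2" by (rule divide_right_mono) simp
      then show "(5 * real m ^ 2 - 3 * real m) / (3 * real m + 1)\<^sup>2 \<le> y (3 * m + 1)"
        by (simp add: y_def algebra_simps)
    qed
  qed
  \<comment> \<open>This excludes the other branch \<open>2 * s \<ge> 2 + sqrt 2\<close> of the
    quadratic inequality below.\<close>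
  moreover have "2 * s \<le> 1"
    by (rule LIMSEQ_le_const2[OF y]) (unfold y_def c_def, use cover_extremal_upper(1) in blast)
  moreover have "2 - 4 * 0 \<le> (2 - 2 * s)\<^sup>2"
  proof (rule LIMSEQ_le)
    show "(\<lambda>n. 2 - 4 * (1 / real n)) \<longlonglongrightarrow> 2 - 4 * 0"
      by (intro tendsto_intros lim_1_over_n)
    show "(\<lambda>n. (2 - y n)\<^sup>2) \<longlonglongrightarrow> (2 - 2 * s)\<^sup>2" by (intro tendsto_intros y)
    show "\<exists>N. \<forall>n\<ge>N. 2 - 4 * (1 / real n) \<le> (2 - y n)\<^sup>2"
      using cover_extremal_upper(2) by (auto simp: y_def c_def)
  qed
  then have "sqrt 2 \<le> \<bar>2 - 2 * s\<bar>" using real_sqrt_le_mono by fastforce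
  ultimately show ?thesis unfolding thr by linarith
qed

end
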